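(* Let $s\in\mathbb{N}$ and $p\in\mathbb{N}'$. The $Z$ transform of the sequence $n\mapsto\binom{n}{p}_{F_s}$ is $$\mathcal{Z}\left(\binom{n}{p}_{F_s}\right)=\frac{(-1)^{s+1}z}{\displaystyle\sum_{i=0}^{p+1}(-1)^{\frac{(si+2(s+1))(i+1)}{2}}\binom{p+1}{i}_{F_s}y^{\frac{si(i-1)}{2}}z^{p+1-i}}.$$
   Context: $\mathbb{N}=\{1,2,\dots\}$, $\mathbb{N}'=\mathbb{N}\cup\{0\}$. $x,y$ are indeterminates and we abbreviate $F_n=F_n(x,y)$. The bivariate Fibonacci polynomials are $F_0=0$, $F_1=1$, $F_{n+2}=xF_{n+1}+yF_n$. For $n,k\in\mathbb{N}'$ the bivariate $s$-Fibopolynomial is $\binom{n}{k}_{F_s}=\frac{F_{sn}F_{s(n-1)}\cdots F_{s(n-k+1)}}{F_sF_{2s}\cdots F_{ks}}$ (equal to $1$ for $k=0$ and $k=n$, and to $0$ if $k>n$). The $Z$ transform of a sequence $(a_n)_{n\ge0}$ is $\mathcal{Z}(a_n)=\sum_{n\ge0}a_nz^{-n}$, regarded as a formal power series in $z^{-1}$ with coefficients in $\mathbb{C}(x,y)$ (equivalently, for fixed complex $x,y$, as a function of $z$ for $|z|$ large). *)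

theory Defs
  imports "HOL-Computational_Algebra.Computational_Algebra"
begin

text \<open>
  The field \<open>\<complex>(x,y)\<close> is the fraction field of \<open>\<complex>[x][y]\<close>; the inner polynomial variable
  is \<open>x\<close>, the outer one is \<open>y\<close>.
\<close>

type_synonym cratfun = "complex poly poly fract"

definition indet_x :: cratfun where
  "indet_x = to_fract [:[:0, 1:]:]"

definition indet_y :: cratfun where
  "indet_y = to_fract [:0, 1:]"

fun bfib :: "'a::comm_semiring_1 \<Rightarrow> 'a \<Rightarrow> nat \<Rightarrow> 'a" where
  "bfib x y 0 = 0"
| "bfib x y (Suc 0) = 1"
| "bfib x y (Suc (Suc n)) = x * bfib x y (Suc n) + y * bfib x y n"

definition fibopoly :: "'a::field \<Rightarrow> 'a \<Rightarrow> nat \<Rightarrow> nat \<Rightarrow> nat \<Rightarrow> 'a" where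
  "fibopoly x y s n k =
     (if k > n then 0
      else (\<Prod>j<k. bfib x y (s * (n - j))) / (\<Prod>j=1..k. bfib x y (s * j)))"

text \<open>
  A formal power series in \<open>z\<^sup>-\<^sup>1\<close> is regarded as a formal Laurent series in the
  variable \<open>fls_X = z\<^sup>-\<^sup>1\<close>, so that \<open>z\<close> itself is available and division makes sense.
\<close>

definition zvar :: "'a::field fls" where
  "zvar = fls_X_inv"

definition Z_transform :: "(nat \<Rightarrow> 'a::field) \<Rightarrow> 'a fls" where
  "Z_transform a = fps_to_fls (Abs_fps a)"

lemma inverse_zvar: "inverse (zvar :: 'a::field fls) = fls_X"
  by (simp add: zvar_def fls_inverse_X_inv)

lemma Z_transform_nth:
  "fls_nth (Z_transform a) k = (if k < 0 then 0 else a (nat k))"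
  by (simp add: Z_transform_def)

text \<open>
  No denominator of a Fibopolynomial over \<open>\<complex>(x,y)\<close> vanishes, so the total division of HOL
  does not interfere; in particular the values at \<open>k = 0\<close> and \<open>k = n\<close> are \<open>1\<close>.
\<close>

lemma bfib_indet_nonzero:
  assumes "n > 0"
  shows "bfib indet_x indet_y n \<noteq> 0"
proof -
  let ?p = "\<lambda>n. bfib [:[:0, 1:]:] [:0, 1:] n :: complex poly poly"
  have frac: "bfib indet_x indet_y n = to_fract (?p n)" for n
    by (induction n rule: induct_nat_012)
       (simp_all add: indet_x_def indet_y_def to_fract_add to_fract_mult del: mult_pCons_left mult_pCons_right)
  have eval: "poly (poly (?p n) 1) 1 = of_nat (bfib 1 1 n)" for n
    by (induction n rule: induct_nat_012) simp_all
  have pos: "bfib 1 1 (Suc n) > (0::nat)" for n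
    by (induction n) simp_all
  have "poly (poly (?p n) 1) 1 \<noteq> 0"
    using assms pos[of "n - 1"] by (simp add: eval)
  then show ?thesis
    by (auto simp: frac)
qed

lemma fibopoly_0: "fibopoly x y s n 0 = 1"
  by (simp add: fibopoly_def)

lemma fibopoly_self:
  assumes "s > 0"
  shows "fibopoly indet_x indet_y s n n = 1"
proof -
  have "(\<Prod>j<n. bfib indet_x indet_y (s * (n - j))) = (\<Prod>j=1..n. bfib indet_x indet_y (s * j))"
    by (rule prod.reindex_bij_witness[of _ "\<lambda>j. n - j" "\<lambda>j. n - j"]) auto
  moreover have "(\<Prod>j=1..n. bfib indet_x indet_y (s * j)) \<noteq> 0"
    using assms by (auto simp: bfib_indet_nonzero)
  ultimately show ?thesis
    by (simp add: fibopoly_def)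
qed

end

theory Submission imports Defs begin

text \<open>
  Put \<open>G n = F\<^bsub>sn\<^esub>\<close> and \<open>Q = (-y)\<^sup>s\<close>. Up to the factor \<open>(-1)\<^sup>s\<^sup>+\<^sup>1 z\<^sup>p\<^sup>+\<^sup>1\<close>
  the denominator is \<open>D(1/z)\<close> for \<open>D(w) = \<Sum>\<^sub>i (-1)\<^sup>i Q\<^bsup>i(i-1)/2\<^esup> C(p+1,i) w\<^sup>i\<close>, where \<open>C\<close> denotes
  the Fibopolynomials, so one has to show that \<open>D(w)\<close> times the generating function
  of \<open>n \<mapsto> C(n,p)\<close> is \<open>w\<^sup>p\<close>. The sequence \<open>G\<close> satisfies a recurrence
  \<open>G (n+2) = P * G (n+1) - Q * G n\<close>, and \<open>C(n,p)\<close> is, up to a constant, a product of \<open>p\<close> shifts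
  of \<open>G\<close>. By induction on \<open>p\<close> (Jarden), \<open>D\<close> annihilates every product of \<open>p\<close> solutions of
  this recurrence: the identity \<open>G (i+k) * u (m+k) = G k * u (m+i+k) + Q\<^sup>k * G i * u m\<close> splits
  off one factor \<open>u\<close> and leaves two instances of the claim for the other \<open>p - 1\<close> factors.
\<close>

section \<open>Second-order recurrences\<close>

text \<open>The characteristic polynomial is \<open>t^2 - P t + Q\<close>, so with this sign
  \<open>Q\<close> is the product of its roots.\<close>

definition second_order_rec :: "'a::field \<Rightarrow> 'a \<Rightarrow> (nat \<Rightarrow> 'a) \<Rightarrow> bool" where
  "second_order_rec P Q u \<longleftrightarrow> (\<forall>n. u (Suc (Suc n)) = P * u (Suc n) - Q * u n)"

lemma second_order_recD:
  "second_order_rec P Q u \<Longrightarrow> u (Suc (Suc n)) = P * u (Suc n) - Q * u n"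
  by (simp add: second_order_rec_def)

text \<open>For fixed \<open>k\<close> and \<open>m\<close> both sides satisfy the same recurrence
  in \<open>i\<close>, so \<open>i = 0\<close> and \<open>i = 1\<close> suffice. For
  \<open>i = 1\<close> the difference of the two products is a Casoratian, which gains a factor
  \<open>Q\<close> each time \<open>k\<close> grows by one.\<close>

lemma second_order_rec_product_identity:
  assumes G: "second_order_rec P Q G" and G0: "G 0 = 0" and u: "second_order_rec P Q u"
  shows "G (i + k) * u (m + k) = G k * u (m + i + k) + Q ^ k * G i * u m"
proof (induction i rule: induct_nat_012)
  case 0
  show ?case by (simp add: G0)
next
  case 1
  show ?case
  proof (induction k)
    case 0
    show ?case by (simp add: G0)
  next
    case (Suc k)
    have "G (Suc 0 + Suc k) * u (m + Suc k) - G (Suc k) * u (m + Suc 0 + Suc k)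
        = Q * (G (Suc 0 + k) * u (m + k) - G k * u (m + Suc 0 + k))"
      by (simp add: second_order_recD[OF G] second_order_recD[OF u] algebra_simps)
    also have "\<dots> = Q * (Q ^ k * G (Suc 0) * u m)"
      unfolding Suc.IH by simp
    finally show ?case by (simp add: algebra_simps)
  qed
next
  case (ge2 i)
  have "G (Suc (Suc i) + k) * u (m + k)
      = P * (G (Suc i + k) * u (m + k)) - Q * (G (i + k) * u (m + k))"
    by (simp add: second_order_recD[OF G] algebra_simps)
  also have "\<dots> = G k * u (m + Suc (Suc i) + k) + Q ^ k * G (Suc (Suc i)) * u m"
    unfolding ge2.IH
    by (simp add: second_order_recD[OF G] second_order_recD[OF u] algebra_simps)
  finally show ?case .
qed

text \<open>The recurrence is run backwards, so \<open>delayed P Q u j n\<close> stands for \<open>u (n - j)\<close> with a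
  possibly negative index.\<close>

primrec delayed :: "'a::field \<Rightarrow> 'a \<Rightarrow> (nat \<Rightarrow> 'a) \<Rightarrow> nat \<Rightarrow> nat \<Rightarrow> 'a" where
  "delayed P Q u 0 = u"
| "delayed P Q u (Suc j) =
    (\<lambda>n. case n of 0 \<Rightarrow> (P * delayed P Q u j 0 - delayed P Q u j 1) / Q
         | Suc m \<Rightarrow> delayed P Q u j m)"

lemma second_order_rec_delayed:
  assumes "second_order_rec P Q u" "Q \<noteq> 0"
  shows "second_order_rec P Q (delayed P Q u j)"
proof (induction j)
  case 0
  show ?case by (simp add: assms)
next
  case (Suc j)
  then show ?case
    using \<open>Q \<noteq> 0\<close> by (auto simp: second_order_rec_def split: nat.split)
qed

lemma delayed_eq: "j \<le> n \<Longrightarrow> delayed P Q u j n = u (n - j)"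
  by (induction j arbitrary: n) (auto split: nat.split)

section \<open>Generalized binomial coefficients\<close>

definition seq_binomial :: "(nat \<Rightarrow> 'a::field) \<Rightarrow> nat \<Rightarrow> nat \<Rightarrow> 'a" where
  "seq_binomial G n k = (if k > n then 0 else (\<Prod>j<k. G (n - j)) / (\<Prod>j=1..k. G j))"

lemma fibopoly_eq_seq_binomial:
  "fibopoly x y s n k = seq_binomial (\<lambda>m. bfib x y (s * m)) n k"
  by (simp add: fibopoly_def seq_binomial_def)

lemma seq_binomial_Suc_Suc_mult:
  assumes "\<And>m. m > 0 \<Longrightarrow> G m \<noteq> 0"
  shows "seq_binomial G (Suc n) (Suc k) * G (Suc k) = G (Suc n) * seq_binomial G n k"
  using assms[of "Suc k"]
  by (simp add: seq_binomial_def prod.lessThan_Suc_shift del: prod.lessThan_Suc)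

text \<open>The product of \<open>G (Suc n)\<close> down to \<open>G (Suc n - k)\<close> can lose
  its last or its first factor. At \<open>k = Suc n\<close> both sides vanish, by
  \<open>G 0 = 0\<close> and by the default value of \<open>seq_binomial\<close>.\<close>

lemma seq_binomial_Suc_mult:
  assumes "G 0 = 0" "k \<le> Suc n"
  shows "seq_binomial G (Suc n) k * G (Suc n - k) = G (Suc n) * seq_binomial G n k"
proof (cases "k = Suc n")
  case True
  then show ?thesis using assms by (simp add: seq_binomial_def)
next
  case False
  have "(\<Prod>j<k. G (Suc n - j)) * G (Suc n - k) = G (Suc n) * (\<Prod>j<k. G (n - j))"
    using prod.lessThan_Suc[of "\<lambda>j. G (Suc n - j)" k]
      prod.lessThan_Suc_shift[of "\<lambda>j. G (Suc n - j)" k] by simp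
  with False assms show ?thesis by (simp add: seq_binomial_def)
qed

text \<open>A Pascal rule weighted by \<open>u\<close>: after multiplication by
  \<open>G (Suc p)\<close>, the product identity yields factors \<open>G (Suc p - i)\<close> and
  \<open>G i\<close>, which the two absorption rules turn back into
  \<open>G (Suc p)\<close>.\<close>

lemma seq_binomial_mult_solution:
  assumes G: "second_order_rec P Q G" and G0: "G 0 = 0"
    and G_nz: "\<And>m. m > 0 \<Longrightarrow> G m \<noteq> 0" and u: "second_order_rec P Q u" and "i \<le> Suc p"
  shows "seq_binomial G (Suc p) i * u (m + (Suc p - i))
    = seq_binomial G p i * u (m + Suc p)
      + (case i of 0 \<Rightarrow> 0 | Suc j \<Rightarrow> Q ^ (p - j) * seq_binomial G p j * u m)"
proof -
  have lower_k: "seq_binomial G (Suc p) i * G i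
      = G (Suc p) * (case i of 0 \<Rightarrow> 0 | Suc j \<Rightarrow> seq_binomial G p j)"
    by (cases i) (simp_all add: G0 seq_binomial_Suc_Suc_mult[where G = G, OF G_nz])
  have "G (Suc p) * u (m + (Suc p - i))
      = G (Suc p - i) * u (m + Suc p) + Q ^ (Suc p - i) * G i * u m"
    using second_order_rec_product_identity[OF G G0 u, of i "Suc p - i" m] \<open>i \<le> Suc p\<close> by simp
  then have "seq_binomial G (Suc p) i * (G (Suc p) * u (m + (Suc p - i)))
      = seq_binomial G (Suc p) i
        * (G (Suc p - i) * u (m + Suc p) + Q ^ (Suc p - i) * G i * u m)" by simp
  then have "G (Suc p) * (seq_binomial G (Suc p) i * u (m + (Suc p - i)))
      = (seq_binomial G (Suc p) i * G (Suc p - i)) * u (m + Suc p)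
        + Q ^ (Suc p - i) * (seq_binomial G (Suc p) i * G i) * u m"
    by (simp add: algebra_simps)
  also have "\<dots> = G (Suc p) * (seq_binomial G p i * u (m + Suc p)
      + (case i of 0 \<Rightarrow> 0 | Suc j \<Rightarrow> Q ^ (p - j) * seq_binomial G p j * u m))"
    unfolding seq_binomial_Suc_mult[where G = G, OF G0 \<open>i \<le> Suc p\<close>]
      lower_k by (cases i) (simp_all add: algebra_simps)
  finally show ?thesis using G_nz[of "Suc p"] by simp
qed

section \<open>Jarden's recurrence for products of solutions\<close>

text \<open>If \<open>G n\<close> is a nonzero multiple of \<open>a^n - b^n\<close> with
  \<open>a b = Q\<close>, these are the coefficients of \<open>t^(r-i)\<close> in the product of
  \<open>t - a^(r-1-j) b^j\<close> over \<open>j < r\<close>.\<close>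

definition jarden_coeff :: "(nat \<Rightarrow> 'a::field) \<Rightarrow> 'a \<Rightarrow> nat \<Rightarrow> nat \<Rightarrow> 'a" where
  "jarden_coeff G Q r i = (-1) ^ i * Q ^ (i choose 2) * seq_binomial G r i"

text \<open>The offset \<open>m\<close> stays arbitrary because the induction step uses the
  hypothesis at both \<open>Suc m\<close> and \<open>m\<close>.\<close>

lemma jarden_annihilates_product:
  assumes G: "second_order_rec P Q G" and G0: "G 0 = 0"
    and G_nz: "\<And>m. m > 0 \<Longrightarrow> G m \<noteq> 0" and v: "\<And>j. second_order_rec P Q (v j)"
  shows "(\<Sum>i\<le>Suc p. jarden_coeff G Q (Suc p) i * (\<Prod>j<p. v j (m + (Suc p - i)))) = 0"
proof (induction p arbitrary: m)
  case 0
  show ?case using G_nz[of 1] by (simp add: jarden_coeff_def seq_binomial_def binomial_eq_0)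
next
  case (Suc p)
  let ?A = "\<lambda>n. \<Prod>j<p. v j n"
  let ?r = "Suc (Suc p)"
  let ?\<epsilon> = "\<lambda>i. (-1) ^ i * Q ^ (i choose 2) :: 'a"
  have split: "jarden_coeff G Q ?r i * (\<Prod>j<Suc p. v j (m + (?r - i)))
      = ?\<epsilon> i * ?A (m + (?r - i)) * (seq_binomial G (Suc p) i * v p (m + ?r))
        + ?\<epsilon> i * ?A (m + (?r - i))
          * (case i of 0 \<Rightarrow> 0 | Suc j \<Rightarrow> Q ^ (Suc p - j) * seq_binomial G (Suc p) j * v p m)"
    if "i \<le> ?r" for i
  proof -
    have "jarden_coeff G Q ?r i * (\<Prod>j<Suc p. v j (m + (?r - i)))
        = ?\<epsilon> i * ?A (m + (?r - i)) * (seq_binomial G ?r i * v p (m + (?r - i)))"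
      by (simp add: jarden_coeff_def mult_ac)
    then show ?thesis
      by (simp only: seq_binomial_mult_solution[where u = "v p", OF G G0 G_nz v that] distrib_left)
  qed
  have "(\<Sum>i\<le>?r. ?\<epsilon> i * ?A (m + (?r - i)) * (seq_binomial G (Suc p) i * v p (m + ?r)))
      = v p (m + ?r) * (\<Sum>i\<le>Suc p. jarden_coeff G Q (Suc p) i * ?A (Suc m + (Suc p - i)))"
  proof -
    \<comment> \<open>The top summand drops out; in the others the surplus shift is moved from
      \<open>?r\<close> to \<open>Suc m\<close>.\<close>
    have "seq_binomial G (Suc p) ?r = 0" by (simp add: seq_binomial_def)
    then show ?thesis
      by (subst sum.atMost_Suc)
         (auto simp: jarden_coeff_def sum_distrib_left Suc_diff_le mult_ac
           simp del: sum.atMost_Suc intro!: sum.cong)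
  qed
  also have "\<dots> = 0" using Suc.IH[of "Suc m"] by simp
  finally have first: "(\<Sum>i\<le>?r. ?\<epsilon> i * ?A (m + (?r - i))
      * (seq_binomial G (Suc p) i * v p (m + ?r))) = 0" .
  \<comment> \<open>Since \<open>(j+1 choose 2) + (p + 1 - j) = (j choose 2) + p + 1\<close>, the extra power of \<open>Q\<close>
    does not depend on \<open>j\<close>.\<close>
  have "(\<Sum>i\<le>?r. ?\<epsilon> i * ?A (m + (?r - i))
          * (case i of 0 \<Rightarrow> 0 | Suc j \<Rightarrow> Q ^ (Suc p - j) * seq_binomial G (Suc p) j * v p m))
      = - (Q ^ Suc p) * v p m
        * (\<Sum>j\<le>Suc p. jarden_coeff G Q (Suc p) j * ?A (m + (Suc p - j)))"
  proof -
    have "Q ^ (Suc j choose 2) * Q ^ (Suc p - j) = Q ^ Suc p * Q ^ (j choose 2)"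
      if "j \<le> Suc p" for j
    proof -
      have "(Suc j choose 2) + (Suc p - j) = Suc p + (j choose 2)"
        using that by (simp add: numeral_2_eq_2)
      then show ?thesis by (metis power_add)
    qed
    then have "?\<epsilon> (Suc j) * ?A (m + (?r - Suc j))
          * (Q ^ (Suc p - j) * seq_binomial G (Suc p) j * v p m)
        = - (Q ^ Suc p) * v p m * (jarden_coeff G Q (Suc p) j * ?A (m + (Suc p - j)))"
      if "j \<le> Suc p" for j
      using that by (simp add: jarden_coeff_def mult_ac del: power_Suc) (simp add: mult_ac)
    then show ?thesis
      by (subst sum.atMost_Suc_shift)
         (auto simp only: nat.case sum_distrib_left mult_zero_right add_0 atMost_iff
           intro!: sum.cong)
  qed
  also have "\<dots> = 0" using Suc.IH[of m] by simp
  finally have second: "(\<Sum>i\<le>?r. ?\<epsilon> i * ?A (m + (?r - i))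
      * (case i of 0 \<Rightarrow> 0 | Suc j \<Rightarrow> Q ^ (Suc p - j) * seq_binomial G (Suc p) j * v p m)) = 0" .
  have "(\<Sum>i\<le>?r. jarden_coeff G Q ?r i * (\<Prod>j<Suc p. v j (m + (?r - i))))
      = (\<Sum>i\<le>?r. ?\<epsilon> i * ?A (m + (?r - i)) * (seq_binomial G (Suc p) i * v p (m + ?r)))
        + (\<Sum>i\<le>?r. ?\<epsilon> i * ?A (m + (?r - i))
          * (case i of 0 \<Rightarrow> 0 | Suc j \<Rightarrow> Q ^ (Suc p - j) * seq_binomial G (Suc p) j * v p m))"
    unfolding sum.distrib[symmetric] by (rule sum.cong[OF refl]) (use split in simp)
  then show ?case by (simp only: first second add_0)
qed

section \<open>Generating function of the generalized binomial coefficients\<close>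

text \<open>For \<open>n < p\<close> the factor with \<open>j = n\<close> is \<open>G 0 = 0\<close>,
  so the values at negative indices do no harm and the product agrees with the default
  \<open>0\<close>.\<close>

lemma seq_binomial_eq_prod_delayed:
  assumes "G 0 = 0"
  shows "seq_binomial G n p = (\<Prod>j<p. delayed P Q G j n) / (\<Prod>j=1..p. G j)"
proof (cases "n < p")
  case True
  have "delayed P Q G n n = 0" by (simp add: delayed_eq assms)
  with True have "(\<Prod>j<p. delayed P Q G j n) = 0" by auto
  with True show ?thesis by (simp add: seq_binomial_def)
next
  case False
  then have "(\<Prod>j<p. delayed P Q G j n) = (\<Prod>j<p. G (n - j))"
    by (intro prod.cong) (simp_all add: delayed_eq)
  with False show ?thesis by (simp add: seq_binomial_def)
qed

lemma seq_binomial_generating_function: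
  assumes G: "second_order_rec P Q G" and G0: "G 0 = 0"
    and G_nz: "\<And>m. m > 0 \<Longrightarrow> G m \<noteq> 0" and "Q \<noteq> 0"
  shows "Abs_fps (\<lambda>n. seq_binomial G n p)
      * (\<Sum>i\<le>Suc p. fps_const (jarden_coeff G Q (Suc p) i) * fps_X ^ i) = fps_X ^ p"
proof (rule fps_ext)
  fix n
  let ?c = "jarden_coeff G Q (Suc p)"
  have "fps_nth (Abs_fps (\<lambda>n. seq_binomial G n p)
      * (\<Sum>i\<le>Suc p. fps_const (?c i) * fps_X ^ i)) n
      = (\<Sum>i\<le>Suc p. fps_nth (fps_const (?c i)
          * (Abs_fps (\<lambda>n. seq_binomial G n p) * fps_X ^ i)) n)"
    by (simp add: sum_distrib_left fps_sum_nth mult.left_commute del: sum.atMost_Suc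
        fps_mult_left_const_nth)
  also have "\<dots> = (\<Sum>i\<le>Suc p. ?c i * (if n < i then 0 else seq_binomial G (n - i) p))"
    by (simp add: fps_X_power_mult_right_nth del: sum.atMost_Suc cong: if_cong)
  also have "\<dots> = fps_nth (fps_X ^ p) n"
  proof (cases "n \<le> p")
    case True
    \<comment> \<open>Up to degree \<open>p\<close> only \<open>i = 0\<close> survives, since any
      other term has upper index below \<open>p\<close>.\<close>
    have "seq_binomial G (n - i) p = 0" if "i > 0" "i \<le> n" for i
      using that True by (simp add: seq_binomial_def)
    then have "(\<Sum>i\<le>Suc p. ?c i * (if n < i then 0 else seq_binomial G (n - i) p))
        = (\<Sum>i\<in>{0}. ?c i * (if n < i then 0 else seq_binomial G (n - i) p))"
      by (intro sum.mono_neutral_right) auto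
    also have "\<dots> = seq_binomial G n p"
      by (simp add: jarden_coeff_def seq_binomial_def binomial_eq_0)
    also have "\<dots> = fps_nth (fps_X ^ p) n"
    proof (cases "n = p")
      case True
      have "(\<Prod>j<p. G (p - j)) = (\<Prod>j=1..p. G j)"
        by (rule prod.reindex_bij_witness[of _ "\<lambda>j. p - j" "\<lambda>j. p - j"]) auto
      moreover have "(\<Prod>j=1..p. G j) \<noteq> 0" using G_nz by auto
      ultimately show ?thesis using True by (simp add: seq_binomial_def)
    qed (use True in \<open>simp add: seq_binomial_def fps_X_power_nth\<close>)
    finally show ?thesis .
  next
    case False
    \<comment> \<open>Beyond degree \<open>p\<close> the convolution has all its
      \<open>p + 2\<close> terms, so it is an instance of Jarden's recurrence at offset
      \<open>m\<close>.\<close>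
    define m where "m = n - Suc p"
    have "(\<Sum>i\<le>Suc p. ?c i * (if n < i then 0 else seq_binomial G (n - i) p))
        = (\<Sum>i\<le>Suc p. ?c i * (\<Prod>j<p. delayed P Q G j (m + (Suc p - i)))) / (\<Prod>j=1..p. G j)"
      unfolding sum_divide_distrib
    proof (rule sum.cong[OF refl])
      fix i assume "i \<in> {..Suc p}"
      then have "\<not> n < i" "n - i = m + (Suc p - i)" using False by (auto simp: m_def)
      then show "?c i * (if n < i then 0 else seq_binomial G (n - i) p)
          = ?c i * (\<Prod>j<p. delayed P Q G j (m + (Suc p - i))) / (\<Prod>j=1..p. G j)"
        by (simp add: seq_binomial_eq_prod_delayed[where G = G and P = P and Q = Q, OF G0])
    qed
    also have "\<dots> = 0"
      using jarden_annihilates_product[where v = "delayed P Q G", OF G G0 G_nz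
          second_order_rec_delayed[OF G \<open>Q \<noteq> 0\<close>]] by simp
    finally show ?thesis using False by (simp add: fps_X_power_nth)
  qed
  finally show "fps_nth (Abs_fps (\<lambda>n. seq_binomial G n p)
      * (\<Sum>i\<le>Suc p. fps_const (?c i) * fps_X ^ i)) n = fps_nth (fps_X ^ p) n" .
qed

lemma fps_to_fls_sum: "fps_to_fls (\<Sum>i\<in>A. f i) = (\<Sum>i\<in>A. fps_to_fls (f i))"
  by (induction A rule: infinite_finite_induct) simp_all

section \<open>Application to the Fibopolynomials\<close>

text \<open>This is the product identity for \<open>bfib\<close> itself, with both shifts equal to
  \<open>s\<close> and offset \<open>s * n\<close>, divided by \<open>bfib x y s\<close>.\<close>

lemma second_order_rec_bfib_multiples:
  fixes x y :: "'a::field"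
  assumes "bfib x y s \<noteq> 0"
  shows "second_order_rec (bfib x y (2 * s) / bfib x y s) ((- y) ^ s) (\<lambda>n. bfib x y (s * n))"
  unfolding second_order_rec_def
proof
  fix n
  have "second_order_rec x (- y) (bfib x y)"
    by (simp add: second_order_rec_def)
  from second_order_rec_product_identity[OF this _ this, of s s "s * n"]
  have "bfib x y (2 * s) * bfib x y (s * Suc n)
      = bfib x y s * bfib x y (s * Suc (Suc n)) + (- y) ^ s * bfib x y s * bfib x y (s * n)"
    unfolding mult_2 by (simp add: algebra_simps)
  then show "bfib x y (s * Suc (Suc n))
      = bfib x y (2 * s) / bfib x y s * bfib x y (s * Suc n) - (- y) ^ s * bfib x y (s * n)"
    using assms by (simp add: field_simps del: mult_Suc_right)
qed

lemma two_times_choose_two: "2 * (i choose 2) + i = i * i"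
  by (induction i) (simp_all add: numeral_2_eq_2)

text \<open>The halved exponent differs from the one on the right by the even number
  \<open>2 * (s * i)\<close>. The last sign later joins the power of \<open>y\<close> to form a
  power of \<open>(-y)^s\<close>.\<close>

lemma minus_one_power_exponent:
  "(-1 :: 'a::comm_ring_1) ^ ((s * i + 2 * (s + 1)) * (i + 1) div 2)
    = (-1) ^ (s + 1) * ((-1) ^ i * (-1) ^ (s * (i choose 2)))"
proof -
  have "s * (i * i) = s * (2 * (i choose 2) + i)"
    by (simp only: two_times_choose_two)
  then have "(s * i + 2 * (s + 1)) * (i + 1)
      = 2 * ((s + 1) + (i + (s * (i choose 2) + 2 * (s * i))))"
    by (simp add: algebra_simps)
  then have "(s * i + 2 * (s + 1)) * (i + 1) div 2
      = (s + 1) + (i + (s * (i choose 2) + 2 * (s * i)))"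
    by simp
  then show ?thesis by (simp only: power_add power_mult) simp
qed

lemma triangular_exponent: "s * i * (i - 1) div 2 = s * (i choose 2)"
proof -
  have "2 * (i choose 2) = i * (i - 1)"
    using two_times_choose_two[of i] by (simp add: diff_mult_distrib2)
  then have "s * i * (i - 1) = 2 * (s * (i choose 2))"
    by (metis mult.assoc mult.left_commute)
  then show ?thesis by (simp only: nonzero_mult_div_cancel_left)
qed

lemma zvar_times_X: "zvar * fls_X = (1 :: 'a::field fls)"
  using right_inverse[of "zvar :: 'a fls"] unfolding inverse_zvar by (simp add: zvar_def)

theorem corollary8:
  fixes s p :: nat
  assumes "s \<ge> 1"
  shows "Z_transform (\<lambda>n. fibopoly indet_x indet_y s n p) =
    (-1) ^ (s + 1) * zvar /
    (\<Sum>i=0..p + 1.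
        (-1) ^ ((s * i + 2 * (s + 1)) * (i + 1) div 2)
        * fls_const (fibopoly indet_x indet_y s (p + 1) i * indet_y ^ (s * i * (i - 1) div 2))
        * zvar ^ (p + 1 - i))"
    (is "?Z = ?N / ?D")
proof -
  define G where "G = (\<lambda>n. bfib indet_x indet_y (s * n))"
  define Q where "Q = (- indet_y) ^ s"
  let ?c = "jarden_coeff G Q (Suc p)"
  have G_nz: "G m \<noteq> 0" if "m > 0" for m
    using that assms by (simp add: G_def bfib_indet_nonzero)
  have G0: "G 0 = 0" by (simp add: G_def)
  have "Q \<noteq> 0" by (simp add: Q_def indet_y_def)
  have G: "second_order_rec (bfib indet_x indet_y (2 * s) / bfib indet_x indet_y s) Q G"
    unfolding G_def Q_def using assms
    by (intro second_order_rec_bfib_multiples bfib_indet_nonzero) simp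
  have summand: "(-1) ^ ((s * i + 2 * (s + 1)) * (i + 1) div 2)
        * fls_const (fibopoly indet_x indet_y s (p + 1) i * indet_y ^ (s * i * (i - 1) div 2))
        * zvar ^ (p + 1 - i)
      = (-1) ^ (s + 1) * zvar ^ Suc p * fps_to_fls (fps_const (?c i) * fps_X ^ i)"
    if "i \<le> Suc p" for i
  proof -
    have sgn: "fls_const ((-1) ^ k :: cratfun) = (-1) ^ k" for k
      by (induction k) (simp_all flip: fls_const_mult_const)
    have "zvar ^ Suc p = (zvar ^ (Suc p - i) * zvar ^ i :: cratfun fls)"
      using that by (simp del: power_Suc flip: power_add)
    \<comment> \<open>Trading \<open>z^(p+1-i)\<close> for \<open>z^(p+1)\<close> times a power of
      \<open>fls_X\<close> leaves a polynomial in \<open>1/z\<close>.\<close>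
    then have z: "zvar ^ (Suc p - i) = (zvar ^ Suc p * fls_X ^ i :: cratfun fls)"
      by (simp add: mult.assoc zvar_times_X del: power_Suc flip: power_mult_distrib)
    have Q: "Q ^ k = (-1) ^ (s * k) * indet_y ^ (s * k)" for k
      unfolding Q_def power_mult[symmetric] by (rule power_minus)
    show ?thesis
      unfolding minus_one_power_exponent triangular_exponent fibopoly_eq_seq_binomial G_def[symmetric]
      by (simp add: z jarden_coeff_def Q sgn fls_times_fps_to_fls
          fps_to_fls_power mult_ac del: power_Suc flip: fls_const_mult_const)
  qed
  have D: "?D = (-1) ^ (s + 1) * zvar ^ Suc p
      * fps_to_fls (\<Sum>i\<le>Suc p. fps_const (?c i) * fps_X ^ i)"
    unfolding fps_to_fls_sum sum_distrib_left atLeast0AtMost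
    by (rule sum.cong) (use summand in auto)
  have gen_fun: "Abs_fps (\<lambda>n. seq_binomial G n p)
      * (\<Sum>i\<le>Suc p. fps_const (?c i) * fps_X ^ i) = fps_X ^ p"
    by (rule seq_binomial_generating_function[OF G G0 G_nz \<open>Q \<noteq> 0\<close>])
  have "?Z * ?D = (-1) ^ (s + 1) * zvar ^ Suc p
      * fps_to_fls (Abs_fps (\<lambda>n. seq_binomial G n p)
          * (\<Sum>i\<le>Suc p. fps_const (?c i) * fps_X ^ i))"
    unfolding D unfolding Z_transform_def fibopoly_eq_seq_binomial G_def[symmetric]
    by (simp add: fls_times_fps_to_fls mult_ac del: power_Suc sum.atMost_Suc)
  also have "\<dots> = (-1) ^ (s + 1) * (zvar * (zvar * fls_X) ^ p)"
    by (simp only: gen_fun) (simp add: fps_to_fls_power power_mult_distrib mult_ac)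
  also have "\<dots> = ?N"
    by (simp add: zvar_times_X)
  finally have ZD: "?Z * ?D = ?N" .
  \<comment> \<open>The denominator is nonzero because its product with the transform is the nonzero
    numerator.\<close>
  moreover have "?N \<noteq> 0" by (simp add: zvar_def)
  ultimately have "?D \<noteq> 0" by (metis mult_zero_right)
  from nonzero_eq_divide_eq[OF this, THEN iffD2, OF ZD] show ?thesis .
qed

end
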